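(* Let $d\ge 1$, $n\ge 1$ be integers, let $w_1,\dots,w_d>0$, and let $\mathcal B_d(n)$ be the set of all $d$-ary trees with $n$ vertices. Then $$\sum_{\tau\in\mathcal B_d(n)}\frac{\displaystyle\prod_{v\in\overset{\circ}{\tau}}\frac{\sum_{j=1}^d|\tau^{(vj)}|\,w_j}{|\tau^{(v)}|-1}}{\displaystyle\prod_{v\in\tau}|\tau^{(v)}|\,d^{|\tau^{(v)}|-1}}\left(\frac{w_1+\cdots+w_d}{d}\right)^{|\partial\tau|}=\frac{1}{n!}\left(\frac{w_1+\cdots+w_d}{d}\right)^n.$$
   Context: A $d$-ary tree is a finite set $\tau$ of finite words over the alphabet $\{1,\dots,d\}$ that contains the empty word and is closed under taking prefixes; its vertices are its elements. For a word $v$, $\tau^{(v)}=\{u: vu\in\tau\}$, so $|\tau^{(v)}|$ is the number of descendants of $v$ in $\tau$ including $v$ (and is $0$ if $v\notin\tau$). A vertex $v\in\tau$ is internal if $vj\in\tau$ for some $j\in\{1,\dots,d\}$; $\overset{\circ}{\tau}$ is the set of internal vertices and $\partial\tau=\tau\setminus\overset{\circ}{\tau}$ the set of leaves. Empty products equal $1$. *)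

theory Defs
  imports Complex_Main "HOL-Library.Sublist"
begin

text \<open>Words over the alphabet \<open>{1,\<dots>,d}\<close> are lists of naturals with letters in \<open>{1..d}\<close>.\<close>

definition dary_tree :: "nat \<Rightarrow> nat list set \<Rightarrow> bool" where
  "dary_tree d \<tau> \<longleftrightarrow>
     finite \<tau> \<and> (\<forall>v\<in>\<tau>. set v \<subseteq> {1..d}) \<and> [] \<in> \<tau> \<and>
     (\<forall>v\<in>\<tau>. \<forall>u. prefix u v \<longrightarrow> u \<in> \<tau>)"

definition dary_trees :: "nat \<Rightarrow> nat \<Rightarrow> nat list set set" where
  "dary_trees d n = {\<tau>. dary_tree d \<tau> \<and> card \<tau> = n}"

definition fringe :: "nat list set \<Rightarrow> nat list \<Rightarrow> nat list set" where
  "fringe \<tau> v = {u. v @ u \<in> \<tau>}"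

definition internal_vertices :: "nat \<Rightarrow> nat list set \<Rightarrow> nat list set" where
  "internal_vertices d \<tau> = {v \<in> \<tau>. \<exists>j\<in>{1..d}. v @ [j] \<in> \<tau>}"

definition leaves :: "nat \<Rightarrow> nat list set \<Rightarrow> nat list set" where
  "leaves d \<tau> = \<tau> - internal_vertices d \<tau>"

end

theory Submission
  imports Defs "HOL-Library.FuncSet" "HOL-Computational_Algebra.Formal_Power_Series"
begin

text \<open>Cutting a tree at its root turns the sum into one over \<open>d\<close>-tuples of possibly empty trees, and
  the weight factorises apart from the root factor \<open>\<Sum>j. |\<tau>\<^sub>j| w\<^sub>j\<close>. With \<open>c = (w\<^sub>1 + \<dots> + w\<^sub>d)/d\<close>
  the inductive hypothesis says that the generating function of possibly empty trees agrees
  with \<open>exp (c x)\<close> up to the relevant degree. The factor \<open>|\<tau>\<^sub>j|\<close> replaces one of the \<open>d\<close> copies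
  by \<open>x d/dx exp (c x) = c x exp (c x)\<close>, so each \<open>j\<close> contributes \<open>w\<^sub>j\<close> times the same coefficient
  of \<open>c x exp (d c x)\<close>.\<close>

unbundle fps_syntax

section \<open>Tuples of given total size and products of generating functions\<close>

text \<open>Extensional functions make each tuple a unique object, so tuples can be counted and an
  entry can be removed by resetting it to \<open>undefined\<close>.\<close>

definition forests :: "'b set \<Rightarrow> ('b \<Rightarrow> nat) \<Rightarrow> 'a set \<Rightarrow> nat \<Rightarrow> ('a \<Rightarrow> 'b) set" where
  "forests T sz A m = {f \<in> A \<rightarrow>\<^sub>E T. (\<Sum>j\<in>A. sz (f j)) = m}"

lemma finite_size_le:
  fixes sz :: "'b \<Rightarrow> nat"
  assumes "\<And>k. finite {s \<in> T. sz s = k}"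
  shows "finite {s \<in> T. sz s \<le> m}"
proof -
  have "{s \<in> T. sz s \<le> m} = (\<Union>k\<le>m. {s \<in> T. sz s = k})"
    by auto
  then show ?thesis
    using assms by simp
qed

lemma finite_forests:
  assumes "finite A" and "\<And>k. finite {s \<in> T. sz s = k}"
  shows "finite (forests T sz A m)"
proof (rule finite_subset)
  show "forests T sz A m \<subseteq> A \<rightarrow>\<^sub>E {s \<in> T. sz s \<le> m}"
    using assms(1) by (auto simp: forests_def PiE_iff extensional_def intro: member_le_sum)
  show "finite (A \<rightarrow>\<^sub>E {s \<in> T. sz s \<le> m})"
    using assms by (intro finite_PiE finite_size_le)
qed

text \<open>Splits off the entry at the new index. The bound \<open>sz s \<le> m\<close> keeps the
  natural subtraction \<open>m - sz s\<close> exact.\<close>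

lemma forests_insert:
  assumes "finite A" "a \<notin> A"
  shows "bij_betw (\<lambda>(s, f). f(a := s))
    (SIGMA s : {s \<in> T. sz s \<le> m}. forests T sz A (m - sz s))
    (forests T sz (insert a A) m)"
proof (rule bij_betw_byWitness[where f' = "\<lambda>f. (f a, f(a := undefined))"])
  have sum_upd: "(\<Sum>j\<in>A. sz ((f(a := s)) j)) = (\<Sum>j\<in>A. sz (f j))" for f s
    using assms by (intro sum.cong) auto
  show "\<forall>x\<in>SIGMA s : {s \<in> T. sz s \<le> m}. forests T sz A (m - sz s).
      (\<lambda>f. (f a, f(a := undefined))) ((\<lambda>(s, f). f(a := s)) x) = x"
    using assms by (auto simp: forests_def PiE_iff extensional_def fun_eq_iff)
  show "\<forall>f\<in>forests T sz (insert a A) m.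
      (\<lambda>(s, f). f(a := s)) (f a, f(a := undefined)) = f"
    by auto
  show "(\<lambda>(s, f). f(a := s)) ` (SIGMA s : {s \<in> T. sz s \<le> m}. forests T sz A (m - sz s))
      \<subseteq> forests T sz (insert a A) m"
    using assms by (auto simp: forests_def PiE_iff extensional_def sum_upd simp del: fun_upd_apply)
      (auto simp: sum_upd)
  show "(\<lambda>f. (f a, f(a := undefined))) ` forests T sz (insert a A) m
      \<subseteq> (SIGMA s : {s \<in> T. sz s \<le> m}. forests T sz A (m - sz s))"
    using assms by (auto simp: forests_def PiE_iff extensional_def sum_upd simp del: fun_upd_apply)
      (auto simp: sum_upd)
qed

text \<open>Product rule for generating functions. Agreement with \<open>G j\<close> is asked only
  up to degree \<open>m\<close>, which is all that an induction on size can supply. The weight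
  \<open>h\<close> may vary with the index, so one entry can be treated differently from the
  others.\<close>

lemma sum_forests_prod:
  fixes G :: "'a \<Rightarrow> 'c::comm_ring_1 fps"
  assumes "finite A"
    and fin: "\<And>k. finite {s \<in> T. sz s = k}"
    and "\<And>j k. \<lbrakk>j \<in> A; k \<le> m\<rbrakk> \<Longrightarrow> (\<Sum>s | s \<in> T \<and> sz s = k. h j s) = G j $ k"
  shows "(\<Sum>f\<in>forests T sz A m. \<Prod>j\<in>A. h j (f j)) = (\<Prod>j\<in>A. G j) $ m"
  using assms(1,3)
proof (induction A arbitrary: m rule: finite_induct)
  case empty
  show ?case
    by (cases "m = 0") (simp_all add: forests_def)
next
  case (insert a A)
  let ?P = "\<lambda>k. \<Sum>f\<in>forests T sz A k. \<Prod>j\<in>A. h j (f j)"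
  have prod_upd: "(\<Prod>j\<in>A. h j ((f(a := s)) j)) = (\<Prod>j\<in>A. h j (f j))" for f s
    using insert.hyps by (intro prod.cong) auto
  have "(\<Sum>f\<in>forests T sz (insert a A) m. \<Prod>j\<in>insert a A. h j (f j))
      = (\<Sum>(s, f)\<in>(SIGMA s : {s \<in> T. sz s \<le> m}. forests T sz A (m - sz s)).
           h a s * (\<Prod>j\<in>A. h j (f j)))"
    using insert.hyps
    by (subst sum.reindex_bij_betw[OF forests_insert, symmetric])
      (auto simp: case_prod_unfold prod_upd simp del: fun_upd_apply, simp)
  also have "\<dots> = (\<Sum>s | s \<in> T \<and> sz s \<le> m. h a s * ?P (m - sz s))"
    using insert.hyps fin
    by (subst sum.Sigma[symmetric])
      (auto simp: sum_distrib_left intro: finite_size_le finite_forests)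
  \<comment> \<open>Grouping by the size of the split-off entry produces the Cauchy product.\<close>
  also have "\<dots> = (\<Sum>k\<in>{0..m}. \<Sum>s | s \<in> {s \<in> T. sz s \<le> m} \<and> sz s = k.
      h a s * ?P (m - sz s))"
    by (rule sum.group[symmetric]) (auto intro: finite_size_le fin)
  also have "\<dots> = (\<Sum>k\<in>{0..m}. G a $ k * (\<Prod>j\<in>A. G j) $ (m - k))"
  proof (rule sum.cong[OF refl])
    fix k assume k: "k \<in> {0..m}"
    have "{s \<in> {s \<in> T. sz s \<le> m}. sz s = k} = {s \<in> T. sz s = k}"
      using k by auto
    then have "(\<Sum>s | s \<in> {s \<in> T. sz s \<le> m} \<and> sz s = k. h a s * ?P (m - sz s))
        = (\<Sum>s | s \<in> T \<and> sz s = k. h a s) * ?P (m - k)"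
      by (simp add: sum_distrib_right)
    also have "?P (m - k) = (\<Prod>j\<in>A. G j) $ (m - k)"
      by (rule insert.IH) (use insert.prems in auto)
    finally show "(\<Sum>s | s \<in> {s \<in> T. sz s \<le> m} \<and> sz s = k. h a s * ?P (m - sz s))
        = G a $ k * (\<Prod>j\<in>A. G j) $ (m - k)"
      using insert.prems k by simp
  qed
  also have "\<dots> = (\<Prod>j\<in>insert a A. G j) $ m"
    using insert.hyps by (simp add: fps_mult_nth)
  finally show ?case .
qed

section \<open>Possibly empty trees\<close>

text \<open>Unlike \<^const>\<open>dary_tree\<close>, this admits the empty set, which stands for a missing subtree.\<close>

definition subtrees :: "nat \<Rightarrow> nat list set set" where
  "subtrees d = {\<tau>. finite \<tau> \<and> (\<forall>v\<in>\<tau>. set v \<subseteq> {1..d}) \<and> (\<forall>v\<in>\<tau>. \<forall>u. prefix u v \<longrightarrow> u \<in> \<tau>)}"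

text \<open>A nonempty prefix-closed set contains the empty word, so only the empty set is excluded
  by \<open>n \<ge> 1\<close>.\<close>

lemma subtrees_card_eq_dary_trees:
  assumes "n \<ge> 1"
  shows "{\<tau> \<in> subtrees d. card \<tau> = n} = dary_trees d n"
proof -
  have "[] \<in> \<tau>" if "\<tau> \<in> subtrees d" "card \<tau> = n" for \<tau>
  proof -
    have "\<tau> \<noteq> {}" using that assms by auto
    then show ?thesis using that by (auto simp: subtrees_def)
  qed
  then show ?thesis
    by (auto simp: dary_trees_def dary_tree_def subtrees_def)
qed

text \<open>A vertex brings all its prefixes into the tree, so the number of vertices bounds the
  word lengths, and only finitely many words qualify.\<close>

lemma finite_subtrees_card: "finite {\<tau> \<in> subtrees d. card \<tau> = k}"
proof (rule finite_subset)
  have "length v \<le> k" if "\<tau> \<in> subtrees d" "card \<tau> = k" "v \<in> \<tau>" for \<tau> v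
  proof -
    have "set (prefixes v) \<subseteq> \<tau>" "finite \<tau>"
      using that by (auto simp: subtrees_def)
    then have "card (set (prefixes v)) \<le> k"
      using that card_mono by blast
    then show ?thesis
      by (simp add: distinct_card)
  qed
  then show "{\<tau> \<in> subtrees d. card \<tau> = k} \<subseteq> Pow {v. set v \<subseteq> {1..d} \<and> length v \<le> k}"
    by (auto simp: subtrees_def)
  show "finite (Pow {v. set v \<subseteq> {1..d} \<and> length v \<le> k})"
    by (simp add: finite_lists_length_le)
qed

section \<open>Cutting and grafting at the root\<close>

text \<open>An empty \<open>f j\<close> means that the new root has no child
  \<open>j\<close>.\<close>

definition graft :: "nat \<Rightarrow> (nat \<Rightarrow> nat list set) \<Rightarrow> nat list set" where
  "graft d f = insert [] (\<Union>j\<in>{1..d}. (#) j ` f j)"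

lemma fringe_Nil [simp]: "fringe \<tau> [] = \<tau>"
  by (simp add: fringe_def)

lemma fringe_append: "fringe \<tau> (u @ v) = fringe (fringe \<tau> u) v"
  by (simp add: fringe_def)

text \<open>Grafting leaves the subtrees below the root unchanged; this is why the weight
  factorises.\<close>

lemma fringe_graft: "j \<in> {1..d} \<Longrightarrow> fringe (graft d f) (j # u) = fringe (f j) u"
  by (auto simp: fringe_def graft_def)

lemma subtrees_finite: "\<tau> \<in> subtrees d \<Longrightarrow> finite \<tau>"
  by (simp add: subtrees_def)

lemma prod_graft:
  assumes "\<And>j. j \<in> {1..d} \<Longrightarrow> finite (f j)"
  shows "(\<Prod>v\<in>graft d f. g v) = g [] * (\<Prod>j=1..d. \<Prod>u\<in>f j. (g (j # u) :: 'a::comm_monoid_mult))"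
proof -
  have "(\<Prod>v\<in>graft d f. g v) = g [] * (\<Prod>v\<in>(\<Union>j\<in>{1..d}. (#) j ` f j). g v)"
    unfolding graft_def using assms by (subst prod.insert) auto
  also have "(\<Prod>v\<in>(\<Union>j\<in>{1..d}. (#) j ` f j). g v) = (\<Prod>j=1..d. \<Prod>v\<in>(#) j ` f j. g v)"
    using assms by (intro prod.UNION_disjoint) auto
  also have "\<dots> = (\<Prod>j=1..d. \<Prod>u\<in>f j. g (j # u))"
    by (simp add: prod.reindex)
  finally show ?thesis .
qed

lemma card_graft:
  assumes "\<And>j. j \<in> {1..d} \<Longrightarrow> finite (f j)"
  shows "card (graft d f) = Suc (\<Sum>j=1..d. card (f j))"
proof -
  have "card (graft d f) = Suc (card (\<Union>j\<in>{1..d}. (#) j ` f j))"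
    unfolding graft_def using assms by (subst card_insert_disjoint) auto
  also have "card (\<Union>j\<in>{1..d}. (#) j ` f j) = (\<Sum>j=1..d. card ((#) j ` f j))"
    using assms by (intro card_UN_disjoint) auto
  also have "\<dots> = (\<Sum>j=1..d. card (f j))"
    by (intro sum.cong refl card_image) simp
  finally show ?thesis .
qed

lemma graft_in_subtrees:
  assumes "\<And>j. j \<in> {1..d} \<Longrightarrow> f j \<in> subtrees d"
  shows "graft d f \<in> subtrees d"
  unfolding subtrees_def
proof (intro CollectI conjI ballI allI impI)
  show "finite (graft d f)"
    using assms by (auto simp: graft_def subtrees_def)
  show "set v \<subseteq> {1..d}" if "v \<in> graft d f" for v
    using that assms by (auto simp: graft_def subtrees_def) force+
  show "u \<in> graft d f" if v: "v \<in> graft d f" "prefix u v" for u v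
  proof (cases u)
    case Nil
    then show ?thesis by (simp add: graft_def)
  next
    case (Cons j u')
    then obtain v' where "v = j # v'" "prefix u' v'"
      using v(2) by (cases v) auto
    with v(1) have "j \<in> {1..d}" "v' \<in> f j"
      by (auto simp: graft_def)
    moreover from this have "u' \<in> f j"
      using assms[of j] \<open>prefix u' v'\<close> by (auto simp: subtrees_def)
    ultimately show ?thesis
      using Cons by (auto simp: graft_def)
  qed
qed

lemma fringe_in_subtrees:
  assumes "\<tau> \<in> subtrees d"
  shows "fringe \<tau> v \<in> subtrees d"
proof -
  have "finite (fringe \<tau> v)"
    using assms finite_vimageI[of \<tau> "(@) v"]
    by (simp add: fringe_def subtrees_def vimage_def inj_def)
  then show ?thesis
    using assms by (fastforce simp: fringe_def subtrees_def)
qed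

lemma graft_fringe:
  assumes "\<tau> \<in> subtrees d" "[] \<in> \<tau>"
  shows "graft d (\<lambda>j\<in>{1..d}. fringe \<tau> [j]) = \<tau>"
proof (rule set_eqI)
  fix v
  show "v \<in> graft d (\<lambda>j\<in>{1..d}. fringe \<tau> [j]) \<longleftrightarrow> v \<in> \<tau>"
  proof (cases v)
    case Nil
    then show ?thesis using assms by (simp add: graft_def)
  next
    case (Cons j u)
    have "j \<in> {1..d}" if "j # u \<in> \<tau>"
      using assms that by (force simp: subtrees_def)
    then show ?thesis
      using Cons by (auto simp: graft_def fringe_def)
  qed
qed

text \<open>The inverse reads off the subtrees at the children of the root, which itself accounts
  for the one extra vertex. Restricting to \<open>{1..d}\<close> makes the resulting tuple
  extensional.\<close>

lemma bij_betw_graft: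
  "bij_betw (graft d) (forests (subtrees d) card {1..d} m) (dary_trees d (Suc m))"
proof (rule bij_betw_byWitness[where f' = "\<lambda>\<tau>. \<lambda>j\<in>{1..d}. fringe \<tau> [j]"])
  have eq: "dary_trees d (Suc m) = {\<tau> \<in> subtrees d. card \<tau> = Suc m}"
    by (simp add: subtrees_card_eq_dary_trees)
  have root: "[] \<in> \<tau>" if "\<tau> \<in> dary_trees d (Suc m)" for \<tau>
    using that by (simp add: dary_trees_def dary_tree_def)
  show "\<forall>f\<in>forests (subtrees d) card {1..d} m. (\<lambda>j\<in>{1..d}. fringe (graft d f) [j]) = f"
    by (auto simp: forests_def fringe_graft PiE_iff extensional_def fun_eq_iff)
  show "\<forall>\<tau>\<in>dary_trees d (Suc m). graft d (\<lambda>j\<in>{1..d}. fringe \<tau> [j]) = \<tau>"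
    using root eq by (intro ballI graft_fringe) auto
  show "graft d ` forests (subtrees d) card {1..d} m \<subseteq> dary_trees d (Suc m)"
    unfolding eq by (auto simp: forests_def intro!: graft_in_subtrees card_graft[THEN trans]
        intro: subtrees_finite)
  show "(\<lambda>\<tau>. \<lambda>j\<in>{1..d}. fringe \<tau> [j]) ` dary_trees d (Suc m)
      \<subseteq> forests (subtrees d) card {1..d} m"
  proof (intro image_subsetI)
    fix \<tau> assume \<tau>: "\<tau> \<in> dary_trees d (Suc m)"
    let ?f = "\<lambda>j\<in>{1..d}. fringe \<tau> [j]"
    have sub: "\<tau> \<in> subtrees d"
      using \<tau> eq by simp
    have "Suc (\<Sum>j=1..d. card (?f j)) = card (graft d ?f)"
      by (rule card_graft[symmetric]) (simp add: fringe_in_subtrees[OF sub] subtrees_finite[of _ d])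
    also have "\<dots> = Suc m"
      using graft_fringe[OF sub root[OF \<tau>]] \<tau> by (simp add: dary_trees_def)
    finally show "?f \<in> forests (subtrees d) card {1..d} m"
      using fringe_in_subtrees[OF sub] by (auto simp: forests_def)
  qed
qed

section \<open>The weight as a product over vertices\<close>

text \<open>The factor of a vertex depends only on the subtree hanging from it. The
  \<open>else\<close> branch gives each leaf one copy of the mean of the \<open>w j\<close>, which
  absorbs the power indexed by the leaves.\<close>

definition local_weight :: "nat \<Rightarrow> (nat \<Rightarrow> real) \<Rightarrow> nat list set \<Rightarrow> real" where
  "local_weight d w \<sigma> =
     (if \<exists>j\<in>{1..d}. [j] \<in> \<sigma>
      then (\<Sum>j=1..d. real (card (fringe \<sigma> [j])) * w j) / (real (card \<sigma>) - 1)
      else (\<Sum>j=1..d. w j) / real d)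
     / (real (card \<sigma>) * real d ^ (card \<sigma> - 1))"

text \<open>The empty tree gets weight 1, matching the constant coefficient of the exponential
  series.\<close>

definition tree_weight :: "nat \<Rightarrow> (nat \<Rightarrow> real) \<Rightarrow> nat list set \<Rightarrow> real" where
  "tree_weight d w \<tau> = (\<Prod>v\<in>\<tau>. local_weight d w (fringe \<tau> v))"

lemma tree_weight_eq:
  assumes "finite \<tau>"
  shows "(\<Prod>v\<in>internal_vertices d \<tau>.
               (\<Sum>j=1..d. real (card (fringe \<tau> (v @ [j]))) * w j)
                 / (real (card (fringe \<tau> v)) - 1))
            / (\<Prod>v\<in>\<tau>. real (card (fringe \<tau> v)) * real d ^ (card (fringe \<tau> v) - 1))
            * ((\<Sum>j=1..d. w j) / real d) ^ card (leaves d \<tau>) = tree_weight d w \<tau>"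
proof -
  let ?I = "internal_vertices d \<tau>"
  let ?num = "\<lambda>v. (\<Sum>j=1..d. real (card (fringe \<tau> (v @ [j]))) * w j)
      / (real (card (fringe \<tau> v)) - 1)"
  let ?c = "(\<Sum>j=1..d. w j) / real d"
  have internal: "(\<exists>j\<in>{1..d}. [j] \<in> fringe \<tau> v) \<longleftrightarrow> v \<in> ?I" if "v \<in> \<tau>" for v
    using that by (auto simp: internal_vertices_def fringe_def)
  have "tree_weight d w \<tau> = (\<Prod>v\<in>\<tau>. (if v \<in> ?I then ?num v else ?c)
      / (real (card (fringe \<tau> v)) * real d ^ (card (fringe \<tau> v) - 1)))"
    unfolding tree_weight_def local_weight_def
    by (intro prod.cong refl) (simp only: internal fringe_append)
  also have "\<dots> = (\<Prod>v\<in>\<tau>. if v \<in> ?I then ?num v else ?c)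
      / (\<Prod>v\<in>\<tau>. real (card (fringe \<tau> v)) * real d ^ (card (fringe \<tau> v) - 1))"
    by (rule prod_dividef)
  also have "(\<Prod>v\<in>\<tau>. if v \<in> ?I then ?num v else ?c) = prod ?num ?I * ?c ^ card (leaves d \<tau>)"
  proof -
    have "\<tau> \<inter> {v. v \<in> ?I} = ?I" "\<tau> \<inter> - {v. v \<in> ?I} = leaves d \<tau>"
      by (auto simp: internal_vertices_def leaves_def)
    then show ?thesis
      using assms by (subst prod.If_cases) simp_all
  qed
  finally show ?thesis
    by simp
qed

lemma tree_weight_graft:
  assumes "\<And>j. j \<in> {1..d} \<Longrightarrow> finite (f j)"
  shows "tree_weight d w (graft d f)
    = local_weight d w (graft d f) * (\<Prod>j=1..d. tree_weight d w (f j))"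
proof -
  have "tree_weight d w (graft d f) = local_weight d w (fringe (graft d f) []) *
      (\<Prod>j=1..d. \<Prod>u\<in>f j. local_weight d w (fringe (graft d f) (j # u)))"
    unfolding tree_weight_def using assms by (rule prod_graft)
  also have "\<dots> = local_weight d w (graft d f) * (\<Prod>j=1..d. tree_weight d w (f j))"
    by (simp add: tree_weight_def fringe_graft)
  finally show ?thesis .
qed

text \<open>Since \<open>m > 0\<close>, some entry is nonempty and the root is internal. The
  denominator depends on \<open>m\<close> alone, so it can be pulled out of a sum over
  tuples.\<close>

lemma local_weight_graft:
  assumes "f \<in> forests (subtrees d) card {1..d} m" "m > 0"
  shows "local_weight d w (graft d f)
    = (\<Sum>j=1..d. real (card (f j)) * w j) / (real m * (real (Suc m) * real d ^ m))"
proof -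
  have sub: "f j \<in> subtrees d" if "j \<in> {1..d}" for j
    using assms that by (auto simp: forests_def)
  have card: "card (graft d f) = Suc m"
    using assms by (subst card_graft) (auto simp: forests_def intro: subtrees_finite[OF sub])
  have "(\<Sum>j=1..d. card (f j)) \<noteq> 0"
    using assms by (simp add: forests_def)
  then obtain j where "j \<in> {1..d}" "card (f j) \<noteq> 0"
    by (meson sum.neutral)
  then have "f j \<noteq> {}"
    by auto
  then have "[] \<in> f j"
    using sub[OF \<open>j \<in> {1..d}\<close>] by (auto simp: subtrees_def)
  then have "\<exists>j\<in>{1..d}. [j] \<in> graft d f"
    using \<open>j \<in> {1..d}\<close> by (intro bexI[of _ j]) (auto simp: graft_def)
  moreover have "(\<Sum>j=1..d. real (card (fringe (graft d f) [j])) * w j)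
      = (\<Sum>j=1..d. real (card (f j)) * w j)"
    by (intro sum.cong) (simp_all add: fringe_graft)
  ultimately show ?thesis
    using card by (simp add: local_weight_def)
qed

section \<open>Induction on the number of vertices\<close>

text \<open>The value at \<open>n = 0\<close> is included because missing subtrees occur in the
  tuples; the induction is strong because the subtrees can have any size below
  \<open>n\<close>.\<close>

lemma sum_tree_weight:
  assumes "d \<ge> 1"
  shows "(\<Sum>\<tau> | \<tau> \<in> subtrees d \<and> card \<tau> = n. tree_weight d w \<tau>)
    = ((\<Sum>j=1..d. w j) / real d) ^ n / fact n"
proof (induction n rule: less_induct)
  case (less n)
  define W where "W = (\<Sum>j=1..d. w j)"
  define c where "c = W / real d"
  have dc: "real d * c = W"
    using assms by (simp add: c_def)
  \<comment> \<open>A single vertex is a leaf and has no quotient factor, so \<open>n = 1\<close> is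
    kept apart from the recursion at the root.\<close>
  consider "n = 0" | "n = 1" | m where "n = Suc m" "m > 0"
    by (metis One_nat_def not0_implies_Suc neq0_conv)
  then show ?case
  proof cases
    case 1
    have "{\<tau> \<in> subtrees d. card \<tau> = 0} = {{}}"
      by (auto simp: subtrees_def)
    with 1 show ?thesis
      by (simp add: tree_weight_def)
  next
    case 2
    have "dary_trees d 1 = {{[]}}"
    proof (intro set_eqI iffI)
      fix \<tau> assume "\<tau> \<in> dary_trees d 1"
      then show "\<tau> \<in> {{[]}}"
        by (auto simp: dary_trees_def dary_tree_def card_1_singleton_iff)
    qed (auto simp: dary_trees_def dary_tree_def)
    with 2 show ?thesis
      by (simp add: subtrees_card_eq_dary_trees tree_weight_def local_weight_def)
  next
    case 3
    have IH: "(\<Sum>\<tau> | \<tau> \<in> subtrees d \<and> card \<tau> = k. tree_weight d w \<tau>) = fps_exp c $ k"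
      if "k \<le> m" for k
      using less.IH[of k] that 3 by (simp add: c_def W_def)
    let ?FS = "forests (subtrees d) card {1..d} m"
    \<comment> \<open>Coefficientwise form of
      \<open>x d/dx exp (c x) = c x exp (c x)\<close>.\<close>
    have shift: "real (Suc l) * c ^ Suc l / fact (Suc l) = c * c ^ l / fact l" for l
      unfolding fact_Suc power_Suc by (simp del: of_nat_Suc)
    \<comment> \<open>The value does not depend on the marked index \<open>i\<close>; this is what
      lets the \<open>w i\<close> later add up to \<open>W\<close>.\<close>
    have marked: "(\<Sum>f\<in>?FS. real (card (f i)) * (\<Prod>j=1..d. tree_weight d w (f j)))
        = c * W ^ (m - 1) / fact (m - 1)" if i: "i \<in> {1..d}" for i
    proof -
      define h where "h j s = (if j = i then real (card s) else 1) * tree_weight d w s" for j s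
      define G where "G j = (if j = i then fps_const c * fps_X else 1) * fps_exp c" for j
      have "(\<Sum>f\<in>?FS. real (card (f i)) * (\<Prod>j=1..d. tree_weight d w (f j)))
          = (\<Sum>f\<in>?FS. \<Prod>j=1..d. h j (f j))"
        using i by (simp add: h_def prod.distrib prod.delta)
      also have "\<dots> = (\<Prod>j=1..d. G j) $ m"
      proof (rule sum_forests_prod)
        fix j k assume "j \<in> {1..d}" "k \<le> m"
        have "(\<Sum>s | s \<in> subtrees d \<and> card s = k. h j s)
            = (if j = i then real k else 1) * fps_exp c $ k"
          unfolding h_def IH[OF \<open>k \<le> m\<close>, symmetric] sum_distrib_left
          by (intro sum.cong) auto
        also have "\<dots> = G j $ k"
          \<comment> \<open>For \<open>k = 0\<close> the marked index gives zero on both sides, by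
            the factor \<open>real k\<close> and by \<open>fps_X\<close>; for
            \<open>k = Suc l\<close> it is \<open>shift\<close>.\<close>
          by (cases k) (simp_all add: G_def mult.assoc shift del: of_nat_Suc fact_Suc power_Suc)
        finally show "(\<Sum>s | s \<in> subtrees d \<and> card s = k. h j s) = G j $ k" .
      qed (simp_all add: finite_subtrees_card)
      \<comment> \<open>The \<open>d\<close> exponentials multiply to
        \<open>exp (d c x) = exp (W x)\<close>, and only index \<open>i\<close> adds the factor
        \<open>c x\<close>.\<close>
      also have "(\<Prod>j=1..d. G j) = fps_const c * (fps_X * fps_exp W)"
        using i by (simp add: G_def prod.distrib prod.delta fps_exp_power_mult dc mult.assoc)
      also have "\<dots> $ m = c * W ^ (m - 1) / fact (m - 1)"
        using \<open>m > 0\<close> by simp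
      finally show ?thesis .
    qed
    have "(\<Sum>\<tau> | \<tau> \<in> subtrees d \<and> card \<tau> = n. tree_weight d w \<tau>)
        = (\<Sum>\<tau>\<in>dary_trees d (Suc m). tree_weight d w \<tau>)"
      using 3 by (simp add: subtrees_card_eq_dary_trees)
    also have "\<dots> = (\<Sum>f\<in>?FS. tree_weight d w (graft d f))"
      by (rule sum.reindex_bij_betw[OF bij_betw_graft, symmetric])
    also have "\<dots> = (\<Sum>f\<in>?FS. (\<Sum>j=1..d. real (card (f j)) * w j)
        / (real m * (real (Suc m) * real d ^ m)) * (\<Prod>j=1..d. tree_weight d w (f j)))"
    proof (rule sum.cong[OF refl])
      fix f assume f: "f \<in> ?FS"
      then have "finite (f j)" if "j \<in> {1..d}" for j
        using that by (auto simp: forests_def intro!: subtrees_finite)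
      then show "tree_weight d w (graft d f) = (\<Sum>j=1..d. real (card (f j)) * w j)
          / (real m * (real (Suc m) * real d ^ m)) * (\<Prod>j=1..d. tree_weight d w (f j))"
        by (subst tree_weight_graft) (simp_all only: local_weight_graft[OF f \<open>m > 0\<close>])
    qed
    also have "\<dots> = (\<Sum>f\<in>?FS. \<Sum>i=1..d. w i *
        (real (card (f i)) * (\<Prod>j=1..d. tree_weight d w (f j))))
        / (real m * (real (Suc m) * real d ^ m))"
      unfolding sum_divide_distrib sum_distrib_right
      by (intro sum.cong refl) (simp only: times_divide_eq_left times_divide_eq_right mult_ac)
    also have "(\<Sum>f\<in>?FS. \<Sum>i=1..d. w i *
        (real (card (f i)) * (\<Prod>j=1..d. tree_weight d w (f j))))
        = (\<Sum>i=1..d. w i * (c * W ^ (m - 1) / fact (m - 1)))"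
      by (subst sum.swap) (simp only: marked sum_distrib_left[symmetric] cong: sum.cong)
    also have "\<dots> = W * (c * W ^ (m - 1) / fact (m - 1))"
      by (simp only: W_def sum_distrib_right)
    \<comment> \<open>Here \<open>W ^ m / d ^ m = c ^ m\<close>, and \<open>m\<close> and
      \<open>Suc m\<close> complete \<open>fact (m - 1)\<close> to \<open>fact n\<close>. Writing
      \<open>m = Suc l\<close> removes the truncated subtraction.\<close>
    also have "\<dots> / (real m * (real (Suc m) * real d ^ m)) = c ^ n / fact n"
    proof -
      obtain l where "m = Suc l"
        using \<open>m > 0\<close> by (cases m) auto
      then show ?thesis
        using 3 assms by (simp add: c_def field_simps)
    qed
    finally show ?thesis
      by (simp add: c_def W_def)
  qed
qed

theorem corollary4p4:
  fixes d n :: nat and w :: "nat \<Rightarrow> real"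
  assumes "d \<ge> 1" and "n \<ge> 1"
    and "\<And>j. j \<in> {1..d} \<Longrightarrow> w j > 0"
  shows "(\<Sum>\<tau>\<in>dary_trees d n.
            (\<Prod>v\<in>internal_vertices d \<tau>.
               (\<Sum>j=1..d. real (card (fringe \<tau> (v @ [j]))) * w j)
                 / (real (card (fringe \<tau> v)) - 1))
            / (\<Prod>v\<in>\<tau>. real (card (fringe \<tau> v)) * real d ^ (card (fringe \<tau> v) - 1))
            * ((\<Sum>j=1..d. w j) / real d) ^ card (leaves d \<tau>))
         = 1 / fact n * ((\<Sum>j=1..d. w j) / real d) ^ n"
proof -
  have "finite \<tau>" if "\<tau> \<in> dary_trees d n" for \<tau>
    using that by (simp add: dary_trees_def dary_tree_def)
  then show ?thesis
    using sum_tree_weight[OF \<open>d \<ge> 1\<close>, of w n]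
    by (simp only: subtrees_card_eq_dary_trees[OF \<open>n \<ge> 1\<close>] tree_weight_eq cong: sum.cong) simp
qed

end
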